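(* For all integers $n \geq 2$, \[ \mathrm{MOF}(K_n) \geq n - \frac{2n}{\log_2(n)}. \]
   Context: An orientation of a simple graph $G$ assigns to each edge $\{u,v\}$ exactly one of the arcs $(u,v)$ or $(v,u)$; if $(u,v)$ is an arc, $v$ is an out-neighbor of $u$. Oriented forcing: given an orientation $D$ and a set $S$ of initially colored vertices, any colored vertex having at most $1$ non-colored out-neighbor forces that out-neighbor to become colored; this rule is applied iteratively as long as possible. $S$ is a forcing set of $D$ if at the end every vertex is colored. $F(D)$ is the minimum size of a forcing set of $D$, and $\mathrm{MOF}(G)$ is the maximum of $F(D)$ over all orientations $D$ of $G$. $K_n$ is the complete graph on $n$ vertices. *)

theory Defs
  imports Complex_Main "Graph_Theory.Graph_Theory"
begin

text \<open>
  A simple graph is a \<^locale>\<open>pair_graph\<close>, i.e. a finite, loop-free, symmetric digraph without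
  parallel arcs: an edge \<open>{u,v}\<close> is represented by the two arcs \<open>(u,v)\<close> and \<open>(v,u)\<close>.
\<close>

definition orientation :: "'a pair_pre_digraph \<Rightarrow> 'a pair_pre_digraph \<Rightarrow> bool" where
  "orientation G D \<longleftrightarrow>
     pverts D = pverts G \<and> parcs D \<subseteq> parcs G \<and>
     (\<forall>(u, v) \<in> parcs G. (u, v) \<in> parcs D \<longleftrightarrow> (v, u) \<notin> parcs D)"

definition out_nbrs :: "'a pair_pre_digraph \<Rightarrow> 'a \<Rightarrow> 'a set" where
  "out_nbrs D u = {v. (u, v) \<in> parcs D}"

text \<open>
  One application of the forcing rule to the set \<open>C\<close> of coloured vertices. A coloured vertex with
  no non-coloured out-neighbour forces nothing, so "at most one" becomes "exactly one" here.
\<close>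

inductive force_step :: "'a pair_pre_digraph \<Rightarrow> 'a set \<Rightarrow> 'a set \<Rightarrow> bool" for D where
  "u \<in> C \<Longrightarrow> out_nbrs D u - C = {v} \<Longrightarrow> force_step D C (insert v C)"

definition forcing_set :: "'a pair_pre_digraph \<Rightarrow> 'a set \<Rightarrow> bool" where
  "forcing_set D S \<longleftrightarrow> S \<subseteq> pverts D \<and> (force_step D)\<^sup>*\<^sup>* S (pverts D)"

definition F :: "'a pair_pre_digraph \<Rightarrow> nat" where
  "F D = Min {card S | S. forcing_set D S}"

definition MOF :: "'a pair_pre_digraph \<Rightarrow> nat" where
  "MOF G = Max {F D | D. orientation G D}"


text \<open>
  The outcome of forcing does not depend on the order of the steps: \<open>S\<close> is a forcing set iff
  every maximal run of the rule starting from \<open>S\<close> ends with all vertices coloured.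
\<close>

lemma force_steps_subset_terminal:
  assumes "(force_step D)\<^sup>*\<^sup>* S T" "S \<subseteq> C" "\<nexists>C'. force_step D C C'"
  shows "T \<subseteq> C"
  using assms
proof (induction rule: rtranclp_induct)
  case (step A B)
  then have "A \<subseteq> C" by simp
  from step.hyps(2) obtain u v where uv: "u \<in> A" "out_nbrs D u - A = {v}" "B = insert v A"
    by (auto elim: force_step.cases)
  have "v \<in> C"
  proof (rule ccontr)
    assume "v \<notin> C"
    then have "out_nbrs D u - C = {v}" using uv \<open>A \<subseteq> C\<close> by blast
    then show False using force_step.intros[of u C D v] uv(1) \<open>A \<subseteq> C\<close> step.prems by blast
  qed
  then show ?case using uv(3) \<open>A \<subseteq> C\<close> by simp
qed

lemma (in pair_wf_digraph) force_steps_in_verts: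
  assumes "(force_step G)\<^sup>*\<^sup>* S C" "S \<subseteq> pverts G"
  shows "C \<subseteq> pverts G"
  using assms
proof (induction rule: rtranclp_induct)
  case (step A B)
  from step.hyps(2) obtain u v where uv: "out_nbrs G u - A = {v}" "B = insert v A"
    by (auto elim: force_step.cases)
  then have "(u, v) \<in> parcs G" by (auto simp: out_nbrs_def)
  then have "v \<in> pverts G" using arc_snd_in_verts[of "(u, v)"] by simp
  then show ?case using uv(2) step by simp
qed

lemma (in pair_fin_digraph) terminal_exists:
  assumes "S \<subseteq> pverts G"
  shows "\<exists>C. (force_step G)\<^sup>*\<^sup>* S C \<and> (\<nexists>C'. force_step G C C')"
proof -
  let ?R = "{C. (force_step G)\<^sup>*\<^sup>* S C}"
  have "?R \<subseteq> Pow (pverts G)" using force_steps_in_verts assms by blast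
  then have fin: "finite ?R" by (rule finite_subset) simp
  have "?R \<noteq> {}" by auto
  from finite_has_maximal[OF fin this] obtain C
    where C: "C \<in> ?R" "\<forall>B\<in>?R. C \<subseteq> B \<longrightarrow> C = B" by blast
  have "\<not> force_step G C C'" for C'
  proof
    assume st: "force_step G C C'"
    then have "C' \<in> ?R" using C(1) by (auto intro: rtranclp.rtrancl_into_rtrancl)
    moreover from st have "C \<subset> C'" by (auto elim!: force_step.cases)
    ultimately show False using C(2) by blast
  qed
  then show ?thesis using C(1) by blast
qed

lemma (in pair_fin_digraph) forcing_set_iff_maximal_runs:
  assumes "S \<subseteq> pverts G"
  shows "forcing_set G S \<longleftrightarrow>
    (\<forall>C. (force_step G)\<^sup>*\<^sup>* S C \<and> (\<nexists>C'. force_step G C C') \<longrightarrow> C = pverts G)"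
proof
  assume fs: "forcing_set G S"
  show "\<forall>C. (force_step G)\<^sup>*\<^sup>* S C \<and> (\<nexists>C'. force_step G C C') \<longrightarrow> C = pverts G"
  proof (intro allI impI)
    fix C assume C: "(force_step G)\<^sup>*\<^sup>* S C \<and> (\<nexists>C'. force_step G C C')"
    have "S \<subseteq> C" using C[THEN conjunct1]
      by (induction rule: rtranclp_induct) (auto elim!: force_step.cases)
    then show "C = pverts G"
      using C fs force_steps_subset_terminal force_steps_in_verts
      unfolding forcing_set_def by blast
  qed
next
  assume "\<forall>C. (force_step G)\<^sup>*\<^sup>* S C \<and> (\<nexists>C'. force_step G C C') \<longrightarrow> C = pverts G"
  then show "forcing_set G S" using terminal_exists[OF assms] assms
    unfolding forcing_set_def by blast
qed


text \<open>The minimum and the maximum above are taken over finite nonempty sets.\<close>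

lemma forcing_set_verts: "forcing_set D (pverts D)"
  by (simp add: forcing_set_def)

lemma finite_forcing_set_cards:
  assumes "finite (pverts D)"
  shows "finite {card S | S. forcing_set D S}"
proof -
  have "{card S | S. forcing_set D S} \<subseteq> card ` Pow (pverts D)"
    by (auto simp: forcing_set_def)
  then show ?thesis by (rule finite_subset) (simp add: assms)
qed

lemma (in pair_graph) orientation_exists: "\<exists>D. orientation G D"
proof -
  obtain f :: "'a \<Rightarrow> nat" where f: "inj_on f (pverts G)"
    using finite_imp_inj_to_nat_seg pair_finite_verts by blast
  let ?D = "\<lparr>pverts = pverts G, parcs = {(u, v) \<in> parcs G. f u < f v}\<rparr>"
  have less: "f u < f v \<longleftrightarrow> \<not> f v < f u" if "(u, v) \<in> parcs G" for u v
  proof -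
    have "u \<in> pverts G" "v \<in> pverts G" "u \<noteq> v"
      using in_arcsD1[OF that] in_arcsD2[OF that] pair_no_loops[OF that] by simp_all
    then have "f u \<noteq> f v" using inj_on_eq_iff[OF f] by blast
    then show ?thesis by linarith
  qed
  have "(u, v) \<in> parcs ?D \<longleftrightarrow> (v, u) \<notin> parcs ?D" if "(u, v) \<in> parcs G" for u v
  proof -
    have "(v, u) \<in> parcs G" using arcs_symmetric[of u v] that by simp
    then show ?thesis using that less[OF that] by simp
  qed
  then have "orientation G ?D"
    unfolding orientation_def by simp blast
  then show ?thesis ..
qed

lemma (in pair_graph) finite_orientation_F: "finite {F D | D. orientation G D}"
proof -
  let ?h = "\<lambda>A. F \<lparr>pverts = pverts G, parcs = A\<rparr>"
  have "{F D | D. orientation G D} \<subseteq> ?h ` Pow (parcs G)"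
  proof
    fix x assume "x \<in> {F D | D. orientation G D}"
    then obtain D where D: "x = F D" "orientation G D" by blast
    then have "D = \<lparr>pverts = pverts G, parcs = parcs D\<rparr>" by (simp add: orientation_def)
    then have "x = ?h (parcs D)" using D(1) by simp
    then show "x \<in> ?h ` Pow (parcs G)" using D(2) by (auto simp: orientation_def)
  qed
  then show ?thesis by (rule finite_subset) simp
qed

end

theory Submission
  imports Defs "HOL-Number_Theory.Euler_Criterion"
begin

text \<open>
  Listing the forces \<open>u\<^sub>1 \<rightarrow> v\<^sub>1\<close>, ..., \<open>u\<^sub>k \<rightarrow> v\<^sub>k\<close> of a successful run from \<open>S\<close> shows that a tournament with a
  forcing set of size \<open>n - k\<close> contains a chain of length \<open>k\<close>: each \<open>u\<^sub>i\<close> has the arc to \<open>v\<^sub>i\<close> and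
  receives arcs from all later \<open>v\<^sub>j\<close>. So it suffices to exhibit tournaments without long chains.

  A chain prescribes the direction of \<open>k (k + 1) / 2\<close> distinct edges, and there are at most \<open>n\<^sup>2\<^sup>k\<close> candidates,
  so by counting some tournament has no chain of length \<open>k\<close> as soon as \<open>k + 1 > 4 log\<^sub>2 n\<close>. For
  \<open>k > 2 n / log\<^sub>2 n\<close> this applies when \<open>n \<ge> 84\<close>.

  For \<open>n < 84\<close> take a subtournament of the Paley tournament on \<open>p \<ge> n\<close> vertices, \<open>p\<close> a prime with
  \<open>p mod 4 = 3\<close>. Any two vertices have only \<open>(p - 3) / 4\<close> common in-neighbours, and all but two
  of the \<open>v\<^sub>j\<close> are common in-neighbours of \<open>u\<^sub>1\<close> and \<open>u\<^sub>2\<close>, so chains have length at most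
  \<open>(p + 5) / 4\<close>. Seven primes suffice because \<open>x / log\<^sub>2 x\<close> increases for \<open>x \<ge> 3\<close>.
\<close>

section \<open>Forcing chains\<close>

text \<open>The diagonal is left free: \<open>tournament_of A\<close> relates \<open>u\<close> to
  itself unless \<open>(u, u)\<close> is in \<open>A\<close>. Chains therefore exclude loops by
  explicit disequalities.\<close>

definition tournament_on :: "'a set \<Rightarrow> ('a \<Rightarrow> 'a \<Rightarrow> bool) \<Rightarrow> bool" where
  "tournament_on V E \<longleftrightarrow> (\<forall>u\<in>V. \<forall>v\<in>V. u \<noteq> v \<longrightarrow> (E u v \<longleftrightarrow> \<not> E v u))"

lemma tournament_on_subset: "tournament_on V E \<Longrightarrow> W \<subseteq> V \<Longrightarrow> tournament_on W E"
  unfolding tournament_on_def by blast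

text \<open>Later targets are non-out-neighbours of \<open>u\<close>, which is what a forcing run
  yields in any digraph. In a tournament \<open>w \<noteq> u\<close> turns this into an arc from
  \<open>w\<close> to \<open>u\<close>.\<close>

fun forcing_chain :: "('a \<Rightarrow> 'a \<Rightarrow> bool) \<Rightarrow> 'a list \<Rightarrow> 'a list \<Rightarrow> bool" where
  "forcing_chain E [] [] \<longleftrightarrow> True"
| "forcing_chain E (u # us) (v # vs) \<longleftrightarrow>
     E u v \<and> u \<noteq> v \<and> (\<forall>w\<in>set vs. w \<noteq> u \<and> \<not> E u w) \<and> forcing_chain E us vs"
| "forcing_chain E _ _ \<longleftrightarrow> False"

lemma forcing_chain_length: "forcing_chain E us vs \<Longrightarrow> length us = length vs"
  by (induction E us vs rule: forcing_chain.induct) auto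

lemma forcing_chain_arc_from:
  "forcing_chain E us vs \<Longrightarrow> u \<in> set us \<Longrightarrow> \<exists>v\<in>set vs. E u v"
  by (induction E us vs rule: forcing_chain.induct) auto

text \<open>A repeated source would have an arc to its later target, which its first occurrence
  forbids.\<close>

lemma forcing_chain_distinct_sources: "forcing_chain E us vs \<Longrightarrow> distinct us"
proof (induction E us vs rule: forcing_chain.induct)
  case (2 E u us v vs)
  then show ?case using forcing_chain_arc_from[of E us vs u] by auto
qed auto

lemma forcing_chain_distinct_targets: "forcing_chain E us vs \<Longrightarrow> distinct vs"
proof (induction E us vs rule: forcing_chain.induct)
  case (2 E u us v vs)
  then show ?case by auto
qed auto

lemma forcing_chain_cong:
  assumes "forcing_chain E us vs"
    and "\<And>u v. u \<in> set us \<Longrightarrow> v \<in> set vs \<Longrightarrow> E' u v \<longleftrightarrow> E u v"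
  shows "forcing_chain E' us vs"
  using assms by (induction E us vs rule: forcing_chain.induct) auto

lemma forcing_chain_map:
  assumes "forcing_chain (\<lambda>u v. E (f u) (f v)) us vs" "inj_on f V" "set us \<subseteq> V" "set vs \<subseteq> V"
  shows "forcing_chain E (map f us) (map f vs)"
  using assms
proof (induction "\<lambda>u v. E (f u) (f v)" us vs rule: forcing_chain.induct)
  case (2 u us v vs)
  then show ?case by (auto simp: inj_on_eq_iff)
qed auto

text \<open>Induction from the front of the run prepends the first force. When \<open>u\<close>
  forces \<open>v\<close>, every vertex outside \<open>B\<close> is a non-out-neighbour of
  \<open>u\<close>, and the later targets all lie outside \<open>B\<close>.\<close>

lemma force_steps_chain:
  assumes "(force_step D)\<^sup>*\<^sup>* S T" "finite T"
  shows "\<exists>us vs. forcing_chain (\<lambda>u v. (u, v) \<in> parcs D) us vs \<and> set us \<subseteq> T \<and> set vs \<subseteq> T - S \<and>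
    S \<subseteq> T \<and> length vs + card S = card T"
  using assms(1)
proof (induction rule: converse_rtranclp_induct)
  case base
  show ?case by (intro exI[of _ "[]"]) auto
next
  case (step A B)
  from step.hyps(1) obtain u v where uv: "u \<in> A" "out_nbrs D u - A = {v}" "B = insert v A"
    by (auto elim: force_step.cases)
  from step.IH obtain us vs where
    c: "forcing_chain (\<lambda>u v. (u, v) \<in> parcs D) us vs" "set us \<subseteq> T" "set vs \<subseteq> T - B"
      "B \<subseteq> T" "length vs + card B = card T" by blast
  have "finite A" by (rule finite_subset[OF _ assms(2)]) (use c(4) uv(3) in blast)
  moreover have "v \<notin> A" using uv(2) by blast
  ultimately have "length (v # vs) + card A = card T" using c(5) uv(3) by simp
  moreover have "forcing_chain (\<lambda>u v. (u, v) \<in> parcs D) (u # us) (v # vs)"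
    using uv c by (auto simp: out_nbrs_def)
  moreover have "set (u # us) \<subseteq> T" "set (v # vs) \<subseteq> T - A" "A \<subseteq> T"
    using uv c \<open>v \<notin> A\<close> by auto
  ultimately show ?case by blast
qed

lemma F_attained:
  assumes "finite (pverts D)"
  obtains S where "forcing_set D S" "card S = F D"
proof -
  have "F D \<in> {card S | S. forcing_set D S}"
    unfolding F_def using finite_forcing_set_cards[OF assms] forcing_set_verts
    by (intro Min_in) auto
  then show thesis using that by auto
qed

text \<open>Pull \<open>E\<close> back to an orientation \<open>D\<close> along a bijection. A
  minimum forcing set of \<open>D\<close> leaves n - F(D) vertices to be forced, and these are the
  targets of a chain.\<close>

lemma MOF_complete_ge:
  fixes G :: "'a pair_pre_digraph" and E :: "nat \<Rightarrow> nat \<Rightarrow> bool"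
  assumes G: "K\<^bsub>n\<^esub> (with_proj G)" and E: "tournament_on {..<n} E"
    and chains: "\<And>us vs. forcing_chain E us vs \<Longrightarrow> set us \<subseteq> {..<n} \<Longrightarrow> set vs \<subseteq> {..<n} \<Longrightarrow>
      real (length vs) \<le> b"
  shows "real (MOF G) \<ge> real n - b"
proof -
  have V: "finite (pverts G)" "card (pverts G) = n"
    and arcs: "parcs G = {(u, v). (u, v) \<in> pverts G \<times> pverts G \<and> u \<noteq> v}"
    using G unfolding complete_digraph_pair_def by blast+
  interpret pair_graph G using pair_graphI_complete[OF G] .
  obtain f where f: "bij_betw f (pverts G) {..<n}"
    using ex_bij_betw_finite_nat[OF V(1)] V(2) by (auto simp: atLeast0LessThan)
  then have inj: "inj_on f (pverts G)" and img: "\<And>u. u \<in> pverts G \<Longrightarrow> f u < n"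
    by (auto simp: bij_betw_def)
  define D where "D = \<lparr>pverts = pverts G, parcs = {(u, v) \<in> parcs G. E (f u) (f v)}\<rparr>"
  have D: "orientation G D"
    using E inj img unfolding orientation_def D_def arcs tournament_on_def
    by (auto simp: inj_on_eq_iff)
  have "pverts D = pverts G" by (simp add: D_def)
  obtain S where S: "forcing_set D S" "card S = F D"
    using F_attained[of D] V(1) \<open>pverts D = pverts G\<close> by auto
  from S(1) have "(force_step D)\<^sup>*\<^sup>* S (pverts G)"
    by (simp add: forcing_set_def \<open>pverts D = pverts G\<close>)
  from force_steps_chain[OF this V(1)] obtain us vs where
    c: "forcing_chain (\<lambda>u v. (u, v) \<in> parcs D) us vs" "set us \<subseteq> pverts G" "set vs \<subseteq> pverts G - S"
      "length vs + card S = n" using V(2) by blast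
  \<comment> \<open>Arcs of \<open>D\<close> are never loops, whereas \<open>E\<close> may have
    loops; the disequalities in the chain absorb the difference.\<close>
  have "forcing_chain (\<lambda>u v. u \<noteq> v \<and> E (f u) (f v)) us vs"
    by (rule forcing_chain_cong[OF c(1)]) (use c(2,3) in \<open>auto simp: D_def arcs\<close>)
  then have "forcing_chain (\<lambda>u v. E (f u) (f v)) us vs"
    by (induction "\<lambda>u v. u \<noteq> v \<and> E (f u) (f v)" us vs rule: forcing_chain.induct) auto
  then have "forcing_chain E (map f us) (map f vs)"
    by (rule forcing_chain_map[OF _ inj]) (use c in auto)
  then have "real (length (map f vs)) \<le> b"
    by (rule chains) (use c img in auto)
  then have "real n - b \<le> real (F D)" using c(4) S(2) by simp
  moreover have "F D \<le> MOF G"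
    unfolding MOF_def using finite_orientation_F D by (intro Max_ge) auto
  ultimately show ?thesis by linarith
qed

text \<open>The targets after the second are in-neighbours of both \<open>u1\<close> and
  \<open>u2\<close>; the \<open>+ 2\<close> pays for the first two.\<close>

lemma forcing_chain_length_le_common:
  assumes "tournament_on V E" "finite V" "forcing_chain E us vs" "set us \<subseteq> V" "set vs \<subseteq> V"
    and "\<And>x y. x \<in> V \<Longrightarrow> y \<in> V \<Longrightarrow> x \<noteq> y \<Longrightarrow> card {z \<in> V. E z x \<and> E z y} \<le> c"
  shows "length vs \<le> c + 2"
proof (cases "length vs \<le> 2")
  case False
  then obtain v1 v2 vs' where vs: "vs = v1 # v2 # vs'"
    by (metis Suc_le_length_iff nat_le_linear numeral_2_eq_2)
  with forcing_chain_length[OF assms(3)] obtain u1 u2 us' where us: "us = u1 # u2 # us'"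
    by (metis Suc_length_conv length_Cons)
  have "u1 \<noteq> u2" using forcing_chain_distinct_sources[OF assms(3)] us by auto
  have "set vs' \<subseteq> {z \<in> V. E z u1 \<and> E z u2}"
  proof
    fix z assume "z \<in> set vs'"
    then have "z \<noteq> u1" "\<not> E u1 z" "z \<noteq> u2" "\<not> E u2 z" "z \<in> V" "u1 \<in> V" "u2 \<in> V"
      using assms(3-5) unfolding us vs by auto
    then show "z \<in> {z \<in> V. E z u1 \<and> E z u2}"
      using assms(1) unfolding tournament_on_def by blast
  qed
  then have "card (set vs') \<le> card {z \<in> V. E z u1 \<and> E z u2}"
    by (intro card_mono) (use assms(2) in auto)
  also have "\<dots> \<le> c" using assms(4,6) \<open>u1 \<noteq> u2\<close> us by auto
  finally show ?thesis
    using forcing_chain_distinct_targets[OF assms(3)] distinct_card[of vs'] by (simp add: vs)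
qed auto

section \<open>Tournaments without long chains by counting\<close>

text \<open>The pairs (u_i, v_j) with i \<le> j, on which a chain decides the relation.\<close>

fun chain_pairs :: "'a list \<Rightarrow> 'a list \<Rightarrow> ('a \<times> 'a) set" where
  "chain_pairs (u # us) (v # vs) = Pair u ` set (v # vs) \<union> chain_pairs us vs"
| "chain_pairs _ _ = {}"

lemma chain_pairs_subset: "chain_pairs us vs \<subseteq> set us \<times> set vs"
  by (induction us vs rule: chain_pairs.induct) auto

text \<open>Distinct sources keep the rows disjoint, and distinct targets give them sizes k, k - 1,
  ..., 1.\<close>

lemma card_chain_pairs:
  "forcing_chain E us vs \<Longrightarrow>
    2 * card (chain_pairs us vs) = length vs * (length vs + 1)"
proof (induction E us vs rule: forcing_chain.induct)
  case (2 E u us v vs)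
  have "u \<notin> set us" "distinct (v # vs)"
    using forcing_chain_distinct_sources[OF 2(2)] forcing_chain_distinct_targets[OF 2(2)] by auto
  have fin: "finite (chain_pairs us vs)"
    by (rule finite_subset[OF chain_pairs_subset]) simp
  have "Pair u ` set (v # vs) \<inter> chain_pairs us vs = {}"
    using chain_pairs_subset[of us vs] \<open>u \<notin> set us\<close> by auto
  then have "card (chain_pairs (u # us) (v # vs)) = card (Pair u ` set (v # vs)) + card (chain_pairs us vs)"
    using fin by (simp only: chain_pairs.simps) (intro card_Un_disjoint, auto)
  also have "card (Pair u ` set (v # vs)) = length (v # vs)"
    using distinct_card[OF \<open>distinct (v # vs)\<close>] by (subst card_image) (auto simp: inj_on_def)
  finally show ?case using 2 by simp
qed auto

text \<open>A source is never a later target, so no edge is prescribed twice.\<close>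

lemma chain_pairs_antisym:
  "forcing_chain E us vs \<Longrightarrow> (a, b) \<in> chain_pairs us vs \<Longrightarrow>
    a \<noteq> b \<and> (b, a) \<notin> chain_pairs us vs"
proof (induction E us vs arbitrary: a b rule: forcing_chain.induct)
  case (2 E u us v vs)
  then show ?case using chain_pairs_subset[of us vs] by auto
qed auto

text \<open>The right-hand side does not mention \<open>E\<close>: all tournaments with this chain
  agree on its pairs.\<close>

lemma forcing_chain_arc_iff:
  "forcing_chain E us vs \<Longrightarrow> (a, b) \<in> chain_pairs us vs \<Longrightarrow> E a b \<longleftrightarrow> (a, b) \<in> set (zip us vs)"
proof (induction E us vs arbitrary: a b rule: forcing_chain.induct)
  case (2 E u us v vs)
  have "u \<notin> set us" "distinct (v # vs)"
    using forcing_chain_distinct_sources[OF 2(2)] forcing_chain_distinct_targets[OF 2(2)] by auto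
  then show ?case using 2 chain_pairs_subset[of us vs] by (auto dest: set_zip_leftD)
qed auto

text \<open>A tournament is encoded by its ascending arcs, so counting tournaments becomes counting
  subsets of the pairs i < j.\<close>

definition tournament_of :: "(nat \<times> nat) set \<Rightarrow> nat \<Rightarrow> nat \<Rightarrow> bool" where
  "tournament_of A u v \<longleftrightarrow> (if u < v then (u, v) \<in> A else (v, u) \<notin> A)"

lemma tournament_on_tournament_of: "tournament_on V (tournament_of A)"
  unfolding tournament_on_def tournament_of_def by (metis less_asym linorder_neqE_nat)

text \<open>The chain fixes k (k + 1) / 2 membership bits of \<open>A\<close>. The bound is
  multiplied out to stay within the naturals.\<close>

lemma card_tournaments_with_chain:
  fixes n k :: nat
  defines "X \<equiv> {(i, j). i < j \<and> j < n}"
  assumes us: "set us \<subseteq> {..<n}" and vs: "set vs \<subseteq> {..<n}" "length vs = k"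
  shows "card {A \<in> Pow X. forcing_chain (tournament_of A) us vs} * 2 ^ (k * (k + 1) div 2) \<le> 2 ^ card X"
proof (cases "\<exists>E. forcing_chain E us vs")
  \<comment> \<open>Some relation with this chain is enough to know the combinatorics of
    \<open>us\<close> and \<open>vs\<close>; if there is none, the counted set is empty.\<close>
  case True
  then obtain E where E: "forcing_chain E us vs" by blast
  let ?m = "\<lambda>(a, b). (min a b, max a b)"
  let ?T = "{A \<in> Pow X. forcing_chain (tournament_of A) us vs}"
  define Q where "Q = ?m ` chain_pairs us vs"
  have [simp]: "finite X" by (rule finite_subset[of _ "{..<n} \<times> {..<n}"]) (auto simp: X_def)
  have "inj_on ?m (chain_pairs us vs)"
  proof (rule inj_onI)
    fix p q assume pq: "p \<in> chain_pairs us vs" "q \<in> chain_pairs us vs" "?m p = ?m q"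
    obtain a b c d where ab: "p = (a, b)" "q = (c, d)" by (meson surj_pair)
    with pq(3) have "p = q \<or> q = (b, a)" by (auto simp: min_def max_def split: if_splits)
    then show "p = q" using chain_pairs_antisym[OF E] pq(1,2) ab(1) by blast
  qed
  then have card: "card Q = k * (k + 1) div 2"
    using card_chain_pairs[OF E] vs(2) by (simp add: Q_def card_image)
  have QX: "Q \<subseteq> X"
  proof
    fix q assume "q \<in> Q"
    then obtain a b where ab: "(a, b) \<in> chain_pairs us vs" "q = (min a b, max a b)"
      by (auto simp: Q_def)
    then have "a \<noteq> b" "a < n" "b < n"
      using chain_pairs_antisym[OF E] chain_pairs_subset[of us vs] us vs by blast+
    then show "q \<in> X" using ab(2) by (auto simp: X_def min_def max_def)
  qed
  \<comment> \<open>On \<open>Q\<close> the tournament is prescribed by the chain, so \<open>A - Q\<close> determines \<open>A\<close>.\<close>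
  have "inj_on (\<lambda>A. A - Q) ?T"
  proof (rule inj_onI)
    fix A B assume AB: "A \<in> ?T" "B \<in> ?T" "A - Q = B - Q"
    have "(min a b, max a b) \<in> A \<longleftrightarrow> (min a b, max a b) \<in> B"
      if ab: "(a, b) \<in> chain_pairs us vs" for a b
    proof -
      have "tournament_of A a b \<longleftrightarrow> tournament_of B a b"
        using AB forcing_chain_arc_iff[OF _ ab] by blast
      moreover have "a \<noteq> b" using chain_pairs_antisym[OF E ab] by blast
      ultimately show ?thesis
        by (auto simp: tournament_of_def min_def max_def split: if_splits)
    qed
    then have "A \<inter> Q = B \<inter> Q" by (auto simp: Q_def)
    then show "A = B" using AB(3) by blast
  qed
  then have "card ?T = card ((\<lambda>A. A - Q) ` ?T)" by (simp add: card_image)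
  also have "\<dots> \<le> card (Pow (X - Q))" by (rule card_mono) auto
  also have "\<dots> = 2 ^ (card X - card Q)"
    using QX by (simp add: card_Pow card_Diff_subset finite_subset)
  finally have "card ?T * 2 ^ card Q \<le> 2 ^ (card X - card Q) * 2 ^ card Q" by simp
  also have "\<dots> = 2 ^ card X"
    using card_mono[OF \<open>finite X\<close> QX] by (simp flip: power_add)
  finally show ?thesis by (simp add: card)
qed simp

text \<open>Union bound over the n^(2k) pairs of vertex lists of length k.\<close>

lemma tournament_without_long_chain:
  fixes n k :: nat
  assumes "n ^ (2 * k) < 2 ^ (k * (k + 1) div 2)"
  obtains E where "tournament_on {..<n} E"
    "\<And>us vs. forcing_chain E us vs \<Longrightarrow> set us \<subseteq> {..<n} \<Longrightarrow> set vs \<subseteq> {..<n} \<Longrightarrow> length vs \<noteq> k"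
proof -
  define X where "X = {(i, j). i < j \<and> j < n}"
  define L where "L = {xs :: nat list. set xs \<subseteq> {..<n} \<and> length xs = k}"
  have [simp]: "finite X" by (rule finite_subset[of _ "{..<n} \<times> {..<n}"]) (auto simp: X_def)
  have L: "finite L" "card L = n ^ k"
    using finite_lists_length_eq[of "{..<n}" k] card_lists_length_eq[of "{..<n}" k] by (auto simp: L_def)
  let ?T = "\<lambda>(us, vs). {A \<in> Pow X. forcing_chain (tournament_of A) us vs}"
  let ?e = "2 ^ (k * (k + 1) div 2) :: nat"
  have "card (\<Union>p\<in>L \<times> L. ?T p) * ?e \<le> (\<Sum>p\<in>L \<times> L. card (?T p)) * ?e"
    by (intro mult_right_mono card_UN_le) (use L in auto)
  also have "\<dots> = (\<Sum>p\<in>L \<times> L. card (?T p) * ?e)" by (rule sum_distrib_right)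
  also have "\<dots> \<le> (\<Sum>p\<in>L \<times> L. 2 ^ card X)"
  proof (rule sum_mono)
    fix p assume "p \<in> L \<times> L"
    then obtain us vs where "p = (us, vs)" "us \<in> L" "vs \<in> L" by blast
    then show "card (?T p) * ?e \<le> 2 ^ card X"
      using card_tournaments_with_chain[of us n vs k] by (simp add: L_def X_def)
  qed
  also have "\<dots> = n ^ (2 * k) * 2 ^ card X"
    by (simp add: card_cartesian_product L mult_2 power_add)
  also have "\<dots> < ?e * 2 ^ card X" using assms by simp
  finally have less: "card (\<Union>p\<in>L \<times> L. ?T p) < card (Pow X)" by (simp add: card_Pow)
  have fin: "finite (\<Union>p\<in>L \<times> L. ?T p)" using L by auto
  have "\<not> Pow X \<subseteq> (\<Union>p\<in>L \<times> L. ?T p)"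
  proof
    assume "Pow X \<subseteq> (\<Union>p\<in>L \<times> L. ?T p)"
    from card_mono[OF fin this] less show False by linarith
  qed
  then obtain A where "A \<in> Pow X" "A \<notin> (\<Union>p\<in>L \<times> L. ?T p)" by blast
  then have "length vs \<noteq> k" if "forcing_chain (tournament_of A) us vs" "set us \<subseteq> {..<n}" "set vs \<subseteq> {..<n}" for us vs
    using that forcing_chain_length[OF that(1)] by (auto simp: L_def)
  then show thesis using that tournament_on_tournament_of by blast
qed

text \<open>Suffixes of chains are chains, so excluding length exactly k excludes all greater
  lengths too.\<close>

lemma forcing_chain_drop:
  "forcing_chain E us vs \<Longrightarrow> forcing_chain E (drop i us) (drop i vs)"
proof (induction E us vs arbitrary: i rule: forcing_chain.induct)
  case (2 E u us v vs)
  then show ?case by (cases i) auto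
qed auto

text \<open>Monotonicity of x / log x, cleared of denominators: ln (x / a) \<le> x / a - 1, and ln a
  \<ge> 1 because a \<ge> 3 \<ge> e.\<close>

lemma log2_mult_le:
  fixes a x :: real
  assumes "3 \<le> a" "a \<le> x"
  shows "log 2 x * a \<le> log 2 a * x"
proof -
  have "1 \<le> ln (3::real)" using exp_le by (simp add: ln_ge_iff)
  also have "\<dots> \<le> ln a" using assms by simp
  finally have "1 \<le> ln a" .
  have "ln x = ln a + ln (x / a)" using assms by (simp add: ln_div)
  also have "\<dots> \<le> ln a + (x / a - 1)" using assms ln_le_minus_one[of "x / a"] by simp
  also have "\<dots> \<le> ln a + ln a * (x / a - 1)"
    using mult_right_mono[OF \<open>1 \<le> ln a\<close>, of "x / a - 1"] assms by simp
  also have "\<dots> = ln a * x / a" using assms by (simp add: field_simps)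
  finally have "ln x * a \<le> ln a * x" using assms by (simp add: field_simps)
  then show ?thesis by (simp add: log_def divide_right_mono field_simps)
qed

text \<open>Applied to square roots, \<open>log2_mult_le\<close> makes log x / sqrt x decreasing
  here. At 84, log_2 84 \<le> 6.4 and 2 * 6.4^2 = 81.92 < 84.\<close>

lemma log2_square_le:
  fixes x :: real
  assumes "84 \<le> x"
  shows "2 * (log 2 x)\<^sup>2 \<le> x"
proof -
  \<comment> \<open>84^5 = 4182119424 is just below 2^32 = 4294967296.\<close>
  have "5 * log 2 84 = log 2 (84 ^ 5 :: real)" by (subst log_nat_power) auto
  also have "\<dots> \<le> log 2 (2 ^ 32)" by (subst log_le_cancel_iff) simp_all
  also have "\<dots> = 32" by (subst log_nat_power) auto
  finally have c: "log 2 84 \<le> (32 / 5 :: real)" by simp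
  have sqrt84: "3 \<le> sqrt (84::real)" by (rule real_le_rsqrt) simp
  have "log 2 (sqrt x) * sqrt 84 \<le> log 2 (sqrt 84) * sqrt x"
    using sqrt84 assms by (intro log2_mult_le) auto
  then have "log 2 x * sqrt 84 \<le> log 2 84 * sqrt x"
    using assms by (simp add: log_def ln_sqrt field_simps)
  also have "\<dots> \<le> 32 / 5 * sqrt x" using c assms by (intro mult_right_mono) auto
  finally have "(log 2 x * sqrt 84)\<^sup>2 \<le> (32 / 5 * sqrt x)\<^sup>2"
    using assms by (intro power_mono) auto
  then have "(log 2 x)\<^sup>2 * 84 \<le> 1024 / 25 * x"
    using assms by (simp add: power_mult_distrib power_divide)
  then show ?thesis using assms by linarith
qed

text \<open>By \<open>log2_square_le\<close>, k exceeds 4 log_2 n; then 2 k log_2 n < k (k + 1) / 2,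
  which is the claim after taking logarithms.\<close>

lemma counting_bound:
  fixes n k :: nat
  assumes "84 \<le> n" "2 * real n / log 2 n < real k"
  shows "n ^ (2 * k) < 2 ^ (k * (k + 1) div 2)"
proof -
  have L: "0 < log 2 (real n)" using assms(1) by simp
  have "4 * log 2 n * log 2 n \<le> 2 * real n"
    using log2_square_le[of n] assms(1) by (simp add: power2_eq_square)
  then have "4 * log 2 n \<le> 2 * real n / log 2 n" using L by (simp add: field_simps)
  then have "4 * log 2 n < real k" using assms(2) by linarith
  then have k: "0 < real k" using L by linarith
  have "log 2 (real n ^ (2 * k)) = real k * (2 * log 2 n)" using assms(1) by (simp add: log_nat_power)
  also have "\<dots> < real k * ((real k + 1) / 2)"
    using \<open>4 * log 2 n < real k\<close> k by (intro mult_strict_left_mono) auto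
  also have "\<dots> = real (k * (k + 1) div 2)"
    by (subst real_of_nat_div) (auto simp: field_simps)
  also have "\<dots> = log 2 (2 ^ (k * (k + 1) div 2))" by (subst log_nat_power) auto
  finally have "real n ^ (2 * k) < 2 ^ (k * (k + 1) div 2)"
    using assms(1) by (subst (asm) log_less_cancel_iff) auto
  then have "real (n ^ (2 * k)) < real (2 ^ (k * (k + 1) div 2))" by simp
  then show ?thesis by (simp only: of_nat_less_iff)
qed

section \<open>Paley tournaments\<close>

lemma Legendre_mod [simp]: "Legendre (a mod p) p = Legendre a p"
  unfolding Legendre_def QuadRes_def cong_def by simp

text \<open>As simp rules these clear the reductions mod p left by substitutions with
  \<open>card_affine_residues\<close>.\<close>

lemma Legendre_mod_arith [simp]:
  "Legendre (a mod p + b) p = Legendre (a + b) p"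
  "Legendre (a mod p - b) p = Legendre (a - b) p"
  "Legendre (b - a mod p) p = Legendre (b - a) p"
  by (metis Legendre_mod mod_add_left_eq mod_diff_left_eq mod_diff_right_eq)+

lemma Legendre_cases: "Legendre a p = 0 \<or> Legendre a p = 1 \<or> Legendre a p = - 1"
  by (simp add: Legendre_def)

lemma Legendre_eq_0_iff: "Legendre a p = 0 \<longleftrightarrow> p dvd a"
  by (simp add: Legendre_def cong_0_iff)

text \<open>Euler's criterion gives the congruence; both sides lie in {-1, 0, 1} and p > 2, so they
  are equal.\<close>

lemma Legendre_mult:
  fixes p :: nat
  assumes "prime p" "p > 2"
  shows "Legendre (a * b) p = Legendre a p * Legendre b p"
proof -
  have "[Legendre (a * b) p = Legendre a p * Legendre b p] (mod p)"
    using cong_trans[OF euler_criterion[OF assms, of "a * b", unfolded power_mult_distrib]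
        cong_sym[OF cong_mult[OF euler_criterion[OF assms, of a] euler_criterion[OF assms, of b]]]] .
  then have "int p dvd Legendre (a * b) p - Legendre a p * Legendre b p"
    by (simp add: cong_iff_dvd_diff)
  moreover have "\<bar>Legendre (a * b) p - Legendre a p * Legendre b p\<bar> < int p"
    using assms(2) by (simp add: Legendre_def)
  ultimately show ?thesis
    using dvd_imp_le_int[of "Legendre (a * b) p - Legendre a p * Legendre b p" "int p"] by auto
qed

text \<open>(p - 1) / 2 is odd, so Euler's criterion makes -1 a non-residue.\<close>

lemma Legendre_minus:
  fixes p :: nat
  assumes "prime p" "p mod 4 = 3"
  shows "Legendre (- a) p = - Legendre a p"
proof -
  have p: "p > 2" using assms prime_gt_1_nat[of p] by (cases "p = 2") auto
  have odd: "odd ((p - 1) div 2)" using assms(2) by presburger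
  have "[Legendre (- 1) p = - 1] (mod p)"
    using euler_criterion[OF assms(1) p, of "- 1"] odd by simp
  then have "int p dvd Legendre (- 1) p + 1" by (simp add: cong_iff_dvd_diff)
  moreover have "0 \<le> Legendre (- 1) p + 1" "Legendre (- 1) p + 1 < int p"
    using p by (simp_all add: Legendre_def)
  ultimately have "Legendre (- 1) p = - 1" using zdvd_imp_le by fastforce
  then show ?thesis using Legendre_mult[OF assms(1) p, of "- 1" a] by simp
qed

text \<open>The affine map permutes the residues mod p; this is the change of variables for all
  counts below.\<close>

lemma card_affine_residues:
  fixes r s p :: int
  assumes "p > 0" "coprime r p"
  shows "card {a \<in> {0..<p}. P ((r * a + s) mod p)} = card {a \<in> {0..<p}. P a}"
proof -
  let ?f = "\<lambda>a. (r * a + s) mod p"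
  have inj: "inj_on ?f {0..<p}"
  proof (rule inj_onI)
    fix a b assume ab: "a \<in> {0..<p}" "b \<in> {0..<p}" "?f a = ?f b"
    then have "[r * a = r * b] (mod p)" by (simp add: cong_def[symmetric] cong_add_rcancel)
    then have "[a = b] (mod p)" using assms(2) by (simp add: cong_mult_lcancel)
    then show "a = b" using ab by (simp add: cong_def)
  qed
  have "{0..<p} = ?f ` {0..<p}"
    by (rule endo_inj_surj[OF _ _ inj, symmetric]) (use assms(1) in auto)
  then have "{a \<in> {0..<p}. P a} = {a \<in> ?f ` {0..<p}. P a}" by (rule arg_cong)
  also have "\<dots> = ?f ` {a \<in> {0..<p}. P (?f a)}" by blast
  finally have "{a \<in> {0..<p}. P a} = ?f ` {a \<in> {0..<p}. P (?f a)}" .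
  moreover have "inj_on ?f {a \<in> {0..<p}. P (?f a)}" by (rule inj_on_subset[OF inj]) auto
  ultimately show ?thesis by (simp add: card_image)
qed

section \<open>Autocorrelation of the set of quadratic residues\<close>

definition residue_pairs :: "nat \<Rightarrow> int \<Rightarrow> nat" where
  "residue_pairs p d = card {a \<in> {0..<int p}. Legendre a p = 1 \<and> Legendre (a + d) p = 1}"

text \<open>Substituting a + d for a exchanges the two conditions.\<close>

lemma residue_pairs_minus:
  assumes "p > 0"
  shows "residue_pairs p (- d) = residue_pairs p d"
proof -
  have "residue_pairs p (- d) =
      card {a \<in> {0..<int p}. Legendre ((1 * a + d) mod p) p = 1 \<and> Legendre ((1 * a + d) mod p - d) p = 1}"
    unfolding residue_pairs_def
    using card_affine_residues[of "int p" 1 "\<lambda>a. Legendre a p = 1 \<and> Legendre (a - d) p = 1" d] assms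
    by simp
  also have "\<dots> = residue_pairs p d"
    unfolding residue_pairs_def
    by (simp add: conj_commute)
  finally show ?thesis .
qed

text \<open>Substituting r a for a lets the residue r factor out of both symbols.\<close>

lemma residue_pairs_mult:
  assumes "prime p" "p > 2" "Legendre r p = 1"
  shows "residue_pairs p (r * d) = residue_pairs p d"
proof -
  have "coprime r (int p)"
    using assms Legendre_eq_0_iff[of r "int p"] prime_imp_coprime[of "int p" r]
    by (auto simp: coprime_commute)
  then have "residue_pairs p (r * d) =
      card {a \<in> {0..<int p}. Legendre ((r * a + 0) mod p) p = 1 \<and> Legendre ((r * a + 0) mod p + r * d) p = 1}"
    unfolding residue_pairs_def
    using card_affine_residues[of "int p" r "\<lambda>a. Legendre a p = 1 \<and> Legendre (a + r * d) p = 1" 0] assms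
    by simp
  also have "\<dots> = card {a \<in> {0..<int p}. Legendre (r * a) p = 1 \<and> Legendre (r * (a + d)) p = 1}"
    by (simp add: distrib_left)
  also have "\<dots> = residue_pairs p d"
    unfolding residue_pairs_def by (simp add: Legendre_mult assms)
  finally show ?thesis .
qed

text \<open>Negation exchanges residues and non-residues, leaving only 0.\<close>

lemma card_residues:
  assumes "prime p" "p mod 4 = 3"
  shows "2 * card {a \<in> {0..<int p}. Legendre a p = 1} + 1 = p"
proof -
  let ?R = "{a \<in> {0..<int p}. Legendre a p = 1}"
  let ?N = "{a \<in> {0..<int p}. Legendre a p = - 1}"
  have "p > 0" using assms(2) by (cases p) auto
  have "Legendre (- a) p = 1 \<longleftrightarrow> Legendre a p = - 1" for a
    using Legendre_minus[OF assms, of a] by linarith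
  then have "card ?N = card {a \<in> {0..<int p}. Legendre ((- 1 * a + 0) mod p) p = 1}"
    by simp
  also have "\<dots> = card ?R" by (rule card_affine_residues) (use \<open>p > 0\<close> in auto)
  finally have NR: "card ?N = card ?R" .
  have eq: "{0..<int p} = insert 0 (?R \<union> ?N)"
  proof -
    have "Legendre a p = 1 \<or> Legendre a p = - 1" if "a \<in> {0..<int p}" "a \<noteq> 0" for a
      using that Legendre_eq_0_iff[of a p] zdvd_not_zless[of a p] by (auto simp: Legendre_def)
    moreover have "0 \<in> {0..<int p}" using \<open>p > 0\<close> by simp
    ultimately show ?thesis by blast
  qed
  have fin: "finite ?R" "finite ?N" by (rule finite_subset[of _ "{0..<int p}"]; auto)+
  have "card {0..<int p} = card (insert 0 (?R \<union> ?N))" by (rule arg_cong[OF eq])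
  also have "\<dots> = Suc (card (?R \<union> ?N))"
    using fin by (intro card_insert_disjoint finite_UnI) (auto simp: Legendre_def)
  also have "card (?R \<union> ?N) = card ?R + card ?N" by (rule card_Un_disjoint[OF fin]) auto
  finally show ?thesis using NR by simp
qed

text \<open>
  As either \<open>d\<close> or \<open>- d\<close> is a square, scaling and reflection make the count independent of \<open>d\<close>;
  its value then follows by summing over all \<open>d\<close>.
\<close>

lemma residue_pairs_eq:
  assumes "prime p" "p mod 4 = 3" "\<not> int p dvd d"
  shows "4 * residue_pairs p d + 3 = p"
proof -
  let ?R = "{a \<in> {0..<int p}. Legendre a p = 1}"
  have p: "p > 2" using assms prime_gt_1_nat[of p] by (cases "p = 2") auto
  have const: "residue_pairs p d = residue_pairs p 1" if "\<not> int p dvd d" for d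
  proof (cases "Legendre d p = 1")
    case True
    then show ?thesis using residue_pairs_mult[OF assms(1) p, of d 1] by simp
  next
    case False
    then have "Legendre (- d) p = 1"
      using that Legendre_eq_0_iff[of d p] Legendre_minus[OF assms(1,2), of d] Legendre_cases[of d p]
      by auto
    then show ?thesis
      using residue_pairs_mult[OF assms(1) p, of "- d" 1] residue_pairs_minus[of p d] p by simp
  qed
  have fin: "finite ?R" by (rule finite_subset[of _ "{0..<int p}"]) auto
  have "(\<Sum>d\<in>{0..<int p}. residue_pairs p d) =
      (\<Sum>d\<in>{0..<int p}. \<Sum>a\<in>?R. of_bool (Legendre (a + d) p = 1))"
    unfolding residue_pairs_def
  proof (rule sum.cong[OF refl])
    fix d
    have "{a \<in> {0..<int p}. Legendre a p = 1 \<and> Legendre (a + d) p = 1} =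
        ?R \<inter> {a. Legendre (a + d) p = 1}" by auto
    then show "card {a \<in> {0..<int p}. Legendre a p = 1 \<and> Legendre (a + d) p = 1} =
        (\<Sum>a\<in>?R. of_bool (Legendre (a + d) p = 1))"
      by (simp only: sum_of_bool_eq[OF fin fin] of_nat_id)
  qed
  also have "\<dots> = (\<Sum>a\<in>?R. \<Sum>d\<in>{0..<int p}. of_bool (Legendre (a + d) p = 1))"
    by (rule sum.swap)
  \<comment> \<open>For a fixed residue a, the sum a + d runs through all classes as d does.\<close>
  also have "\<dots> = (\<Sum>a\<in>?R. card ?R)"
  proof (rule sum.cong[OF refl])
    fix a
    have "(\<Sum>d\<in>{0..<int p}. of_bool (Legendre (a + d) p = 1)) =
        card {d \<in> {0..<int p}. Legendre ((1 * d + a) mod p) p = 1}"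
      by (auto simp: of_bool_def sum.If_cases Int_def add.commute)
    also have "\<dots> = card ?R" by (rule card_affine_residues) (use p in auto)
    finally show "(\<Sum>d\<in>{0..<int p}. of_bool (Legendre (a + d) p = 1)) = card ?R" .
  qed
  finally have total: "(\<Sum>d\<in>{0..<int p}. residue_pairs p d) = card ?R * card ?R" by simp
  have "{0..<int p} = insert 0 {1..<int p}" using p by auto
  then have "(\<Sum>d\<in>{0..<int p}. residue_pairs p d) = residue_pairs p 0 + (\<Sum>d\<in>{1..<int p}. residue_pairs p d)"
    by simp
  also have "residue_pairs p 0 = card ?R" by (simp add: residue_pairs_def)
  also have "(\<Sum>d\<in>{1..<int p}. residue_pairs p d) = (\<Sum>d\<in>{1..<int p}. residue_pairs p 1)"
    by (intro sum.cong refl const) (auto simp: zdvd_not_zless)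
  also have "\<dots> = (p - 1) * residue_pairs p 1" using p by (simp add: nat_diff_distrib)
  finally have sum: "card ?R + (p - 1) * residue_pairs p 1 = card ?R * card ?R" using total by simp
  \<comment> \<open>With m = (p - 1) / 2 and c the common count, m + 2 m c = m^2, hence c = (m - 1)
    / 2 = (p - 3) / 4.\<close>
  define m where "m = card ?R"
  have m: "p = 2 * m + 1" using card_residues[OF assms(1,2)] by (simp only: m_def)
  then have "p - 1 = 2 * m" by simp
  then have "m + 2 * m * residue_pairs p 1 = m * m" using sum by (simp only: m_def)
  then have "m * (1 + 2 * residue_pairs p 1) = m * m" by (simp add: algebra_simps)
  moreover have "m \<noteq> 0" using m p by simp
  ultimately have "1 + 2 * residue_pairs p 1 = m" by (simp only: mult_cancel1 simp_thms)
  then show ?thesis using m const[OF assms(3)] by linarith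
qed

text \<open>Substituting z = x - a turns the two conditions into a and a + (y - x) being
  residues.\<close>

lemma paley_common:
  assumes "prime p" "p mod 4 = 3" "x < p" "y < p" "x \<noteq> y"
  shows "4 * card {z \<in> {..<p}. Legendre (int x - int z) p = 1 \<and> Legendre (int y - int z) p = 1} + 3 = p"
proof -
  have "p > 0" using assms by simp
  let ?A = "{z \<in> {..<p}. Legendre (int x - int z) p = 1 \<and> Legendre (int y - int z) p = 1}"
  let ?B = "{z \<in> {0..<int p}. Legendre (int x - z) p = 1 \<and> Legendre (int y - z) p = 1}"
  have "card ?A = card (int ` ?A)" by (simp add: card_image)
  also have "int ` ?A = ?B"
  proof -
    have "z \<in> int ` ?A" if "z \<in> ?B" for z
      using that by (intro image_eqI[of _ _ "nat z"]) auto
    then show ?thesis by auto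
  qed
  also have "card ?B = card {a \<in> {0..<int p}. Legendre (int x - (- 1 * a + x) mod p) p = 1 \<and>
      Legendre (int y - (- 1 * a + x) mod p) p = 1}"
    using card_affine_residues[of p "- 1" "\<lambda>z. Legendre (int x - z) p = 1 \<and> Legendre (int y - z) p = 1" x]
      \<open>p > 0\<close> by simp
  also have "\<dots> = residue_pairs p (int y - int x)"
    unfolding residue_pairs_def
    by (simp add: algebra_simps)
  finally have "card ?A = residue_pairs p (int y - int x)" .
  moreover have "\<not> int p dvd int y - int x"
    using dvd_imp_le_int[of "int y - int x" "int p"] assms(3-5) by auto
  ultimately show ?thesis using residue_pairs_eq[OF assms(1,2)] by simp
qed

text \<open>As -1 is a non-residue, exactly one of v - u and u - v is a residue.\<close>

lemma paley_tournament:
  assumes "prime p" "p mod 4 = 3"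
  shows "tournament_on {..<p} (\<lambda>u v. Legendre (int v - int u) p = 1)"
  unfolding tournament_on_def
proof (intro ballI impI)
  fix u v assume uv: "u \<in> {..<p}" "v \<in> {..<p}" "u \<noteq> v"
  then have "\<not> int p dvd int v - int u"
    using dvd_imp_le_int[of "int v - int u" "int p"] by auto
  then show "Legendre (int v - int u) p = 1 \<longleftrightarrow> Legendre (int u - int v) p \<noteq> 1"
    using Legendre_minus[OF assms, of "int v - int u"] Legendre_eq_0_iff[of "int v - int u" p]
      Legendre_cases[of "int v - int u" p] by auto
qed

lemma paley_chain_length:
  assumes "prime p" "p mod 4 = 3"
    and "forcing_chain (\<lambda>u v. Legendre (int v - int u) p = 1) us vs" "set us \<subseteq> {..<p}" "set vs \<subseteq> {..<p}"
  shows "length vs \<le> (p + 5) div 4"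
proof -
  have "length vs \<le> (p - 3) div 4 + 2"
  proof (rule forcing_chain_length_le_common[OF paley_tournament[OF assms(1,2)] finite_lessThan assms(3-5)])
    fix x y assume "x \<in> {..<p}" "y \<in> {..<p}" "x \<noteq> y"
    then show "card {z \<in> {..<p}. Legendre (int x - int z) p = 1 \<and> Legendre (int y - int z) p = 1} \<le> (p - 3) div 4"
      using paley_common[OF assms(1,2), of x y] by simp
  qed
  then show ?thesis using assms(2) by presburger
qed

text \<open>The power inequality says (p + 5) / 4 \<le> 2 a / log_2 a in a form that evaluation can
  check; monotonicity carries it from the left end a of a range to every n in it.\<close>

lemma paley_bound:
  fixes a n p :: nat
  assumes "prime p" "p mod 4 = 3" "3 \<le> a" "a \<le> n" "n \<le> p" "a ^ ((p + 5) div 4) \<le> 4 ^ a"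
    and G: "K\<^bsub>n\<^esub> (with_proj G)"
  shows "real (MOF G) \<ge> real n - 2 * real n / log 2 (real n)"
proof (rule MOF_complete_ge[OF G])
  show "tournament_on {..<n} (\<lambda>u v. Legendre (int v - int u) p = 1)"
    by (rule tournament_on_subset[OF paley_tournament[OF assms(1,2)]]) (use assms(5) in auto)
next
  fix us vs
  assume "forcing_chain (\<lambda>u v. Legendre (int v - int u) p = 1) us vs" "set us \<subseteq> {..<n}" "set vs \<subseteq> {..<n}"
  moreover have "{..<n} \<subseteq> {..<p}" using assms(5) by auto
  ultimately have le: "length vs \<le> (p + 5) div 4"
    by (intro paley_chain_length[OF assms(1,2)]) auto
  define k where "k = (p + 5) div 4"
  have "real (a ^ k) \<le> real (4 ^ a)" using assms(6) unfolding k_def by (rule of_nat_mono)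
  then have "log 2 (real a ^ k) \<le> log 2 (2 ^ (2 * a))"
    using assms(3) by (subst log_le_cancel_iff) (auto simp: power_mult)
  also have "\<dots> = 2 * real a" by (subst log_nat_power) auto
  also have "log 2 (real a ^ k) = real k * log 2 a" using assms(3) by (subst log_nat_power) auto
  finally have "real k * log 2 a * real n \<le> 2 * real a * real n" by (rule mult_right_mono) simp
  moreover have "real k * (log 2 n * real a) \<le> real k * (log 2 a * real n)"
    using assms(3,4) by (intro mult_left_mono log2_mult_le) auto
  ultimately have "real a * (real k * log 2 n) \<le> real a * (2 * real n)" by (simp add: algebra_simps)
  then have "real k * log 2 n \<le> 2 * real n" using assms(3) by simp
  then have "real k \<le> 2 * real n / log 2 n" using assms(3,4) by (simp add: pos_le_divide_eq)
  then show "real (length vs) \<le> 2 * real n / log 2 n" using le by (simp add: k_def)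
qed

section \<open>Assembling the ranges of n\<close>

theorem theorem8:
  fixes n :: nat and G :: "'a pair_pre_digraph"
  assumes "n \<ge> 2" and "K\<^bsub>n\<^esub> (with_proj G)"
  shows "real (MOF G) \<ge> real n - 2 * real n / log 2 (real n)"
proof -
  \<comment> \<open>The middle ranges end at the primes 11, 19, 31, 43, 59, 71 and 83, all 3 mod 4,
    and each starts just after the previous range.\<close>
  consider "n \<le> 4" | "5 \<le> n" "n \<le> 11" | "12 \<le> n" "n \<le> 19" | "20 \<le> n" "n \<le> 31"
    | "32 \<le> n" "n \<le> 43" | "44 \<le> n" "n \<le> 59" | "60 \<le> n" "n \<le> 71"
    | "72 \<le> n" "n \<le> 83" | "84 \<le> n" by linarith
  then show ?thesis
  proof cases
    case 1
    \<comment> \<open>Here log_2 n \<le> 2, so the claimed lower bound is at most 0.\<close>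
    have "log 2 n \<le> log 2 (2 ^ 2)" using 1 assms(1) by (subst log_le_cancel_iff) auto
    also have "\<dots> = 2" by (subst log_nat_power) auto
    finally have "real n * log 2 n \<le> real n * 2" by (rule mult_left_mono) simp
    then have "real n \<le> 2 * real n / log 2 n" using assms(1) by (simp add: pos_le_divide_eq mult.commute)
    then show ?thesis by simp
  next
    case 2
    show ?thesis by (rule paley_bound[of 11 5, OF _ _ _ 2 _ assms(2)]) simp_all
  next
    case 3
    show ?thesis by (rule paley_bound[of 19 12, OF _ _ _ 3 _ assms(2)]) simp_all
  next
    case 4
    show ?thesis by (rule paley_bound[of 31 20, OF _ _ _ 4 _ assms(2)]) simp_all
  next
    case 5
    show ?thesis by (rule paley_bound[of 43 32, OF _ _ _ 5 _ assms(2)]) simp_all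
  next
    case 6
    show ?thesis by (rule paley_bound[of 59 44, OF _ _ _ 6 _ assms(2)]) simp_all
  next
    case 7
    show ?thesis by (rule paley_bound[of 71 60, OF _ _ _ 7 _ assms(2)]) simp_all
  next
    case 8
    show ?thesis by (rule paley_bound[of 83 72, OF _ _ _ 8 _ assms(2)]) simp_all
  next
    case 9
    \<comment> \<open>The least integer exceeding the bound: strict excess feeds the counting, and a
      length below \<open>k\<close> is at most the bound.\<close>
    define k where "k = nat \<lfloor>2 * real n / log 2 n\<rfloor> + 1"
    have "0 \<le> 2 * real n / log 2 n" using assms(1) by simp
    then have k: "2 * real n / log 2 n < real k" "real k \<le> 2 * real n / log 2 n + 1"
      unfolding k_def by linarith+
    obtain E where E: "tournament_on {..<n} E"
      "\<And>us vs. forcing_chain E us vs \<Longrightarrow> set us \<subseteq> {..<n} \<Longrightarrow> set vs \<subseteq> {..<n} \<Longrightarrow> length vs \<noteq> k"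
      using tournament_without_long_chain[OF counting_bound[OF 9 k(1)]] by blast
    show ?thesis
    proof (rule MOF_complete_ge[OF assms(2) E(1)])
      fix us vs assume c: "forcing_chain E us vs" "set us \<subseteq> {..<n}" "set vs \<subseteq> {..<n}"
      have "length vs < k"
      proof (rule ccontr)
        let ?i = "length vs - k"
        assume "\<not> length vs < k"
        then have "length (drop ?i vs) = k" by simp
        moreover have "set (drop ?i us) \<subseteq> {..<n}" "set (drop ?i vs) \<subseteq> {..<n}"
          using c(2,3) set_drop_subset by fast+
        ultimately show False using E(2)[OF forcing_chain_drop[OF c(1)]] by blast
      qed
      then show "real (length vs) \<le> 2 * real n / log 2 n" using k(2) by linarith
    qed
  qed
qed

end
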